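(* Let $B$ be a unital C$^*$-algebra and let $T : B \to B$ be a (bounded linear) local triple derivation. Then $T$ is a triple derivation.
   Context: Every C$^*$-algebra $B$ is equipped with the triple product $\{a,b,c\} := \frac12 (ab^*c + cb^*a)$. A (complex) linear map $\delta : B \to B$ is a triple derivation if $\delta\{a,b,c\} = \{\delta(a),b,c\} + \{a,\delta(b),c\} + \{a,b,\delta(c)\}$ for all $a,b,c \in B$. A bounded linear operator $T : B \to B$ is a local triple derivation if for each $a \in B$ there exists a triple derivation $\delta_a : B \to B$ (depending on $a$) with $T(a) = \delta_a(a)$. *)

theory Defs
  imports Complex_Main
begin

class scaleC =
  fixes scaleC :: "complex \<Rightarrow> 'a \<Rightarrow> 'a" (infixr "*\<^sub>C" 75)

class star =
  fixes star :: "'a \<Rightarrow> 'a"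

class cstar_algebra = real_normed_algebra + banach + scaleC + star +
  assumes scaleR_scaleC: "scaleR r x = complex_of_real r *\<^sub>C x"
    and scaleC_add_right: "c *\<^sub>C (x + y) = c *\<^sub>C x + c *\<^sub>C y"
    and scaleC_add_left: "(c + d) *\<^sub>C x = c *\<^sub>C x + d *\<^sub>C x"
    and scaleC_scaleC: "c *\<^sub>C d *\<^sub>C x = (c * d) *\<^sub>C x"
    and scaleC_one: "1 *\<^sub>C x = x"
    and mult_scaleC_left: "(c *\<^sub>C x) * y = c *\<^sub>C (x * y)"
    and mult_scaleC_right: "x * (c *\<^sub>C y) = c *\<^sub>C (x * y)"
    and norm_scaleC: "norm (c *\<^sub>C x) = cmod c * norm x"
    and star_star: "star (star x) = x"
    and star_add: "star (x + y) = star x + star y"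
    and star_scaleC: "star (c *\<^sub>C x) = cnj c *\<^sub>C star x"
    and star_mult: "star (x * y) = star y * star x"
    and cstar_identity: "norm (star x * x) = (norm x)\<^sup>2"

text \<open>
  The unit comes from \<^class>\<open>monoid_mult\<close> rather than \<^class>\<open>real_normed_algebra_1\<close>, so that the
  zero algebra (where \<open>1 = 0\<close>) is included. In every other case \<open>norm 1 = 1\<close> follows from the
  C*-identity.
\<close>

class unital_cstar_algebra = cstar_algebra + monoid_mult

definition clinear :: "('a::cstar_algebra \<Rightarrow> 'b::cstar_algebra) \<Rightarrow> bool" where
  "clinear f \<longleftrightarrow> (\<forall>x y. f (x + y) = f x + f y) \<and> (\<forall>c x. f (c *\<^sub>C x) = c *\<^sub>C f x)"

definition triple_product :: "'a::cstar_algebra \<Rightarrow> 'a \<Rightarrow> 'a \<Rightarrow> 'a" where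
  "triple_product a b c = (1/2) *\<^sub>C (a * star b * c + c * star b * a)"

definition triple_derivation :: "('a::cstar_algebra \<Rightarrow> 'a) \<Rightarrow> bool" where
  "triple_derivation \<delta> \<longleftrightarrow> clinear \<delta> \<and>
    (\<forall>a b c. \<delta> (triple_product a b c) =
       triple_product (\<delta> a) b c + triple_product a (\<delta> b) c + triple_product a b (\<delta> c))"

definition local_triple_derivation :: "('a::cstar_algebra \<Rightarrow> 'a) \<Rightarrow> bool" where
  "local_triple_derivation T \<longleftrightarrow> clinear T \<and> bounded_linear T \<and>
    (\<forall>a. \<exists>\<delta>. triple_derivation \<delta> \<and> T a = \<delta> a)"

end

theory Submission
  imports Defs "HOL-Analysis.Elementary_Normed_Spaces"
begin

text \<open>
  The triple derivation rule, read at a unitary \<open>u\<close>, where \<open>{u,u,u} = u\<close>, says that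
  \<open>\<delta>(u) = - u \<delta>(u)\<^sup>* u\<close>. This relation involves the value of \<open>\<delta>\<close> at the single point \<open>u\<close> only,
  so a local triple derivation \<open>T\<close> inherits it at every unitary. It expresses that the vector \<open>T(u)\<close> is
  tangent at \<open>u\<close> to the unitary group, and it already forces a bounded linear map to be a triple
  derivation.

  At \<open>u = 1\<close> the relation makes \<open>T(1)\<close> skew-adjoint. For a skew-adjoint \<open>h\<close> the map
  \<open>x \<mapsto> hx + xh\<close> is a triple derivation; subtracting it with \<open>h = T(1)/2\<close> reduces the problem to
  \<open>T(1) = 0\<close>. Now take a skew-adjoint \<open>y\<close> and expand the relation along a curve of unitaries through
  \<open>1\<close> with velocity proportional to \<open>y\<close>. The first-order term says that \<open>T(y)\<close> is skew-adjoint, hence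
  that \<open>T\<close> commutes with the involution. The second-order term then says \<open>T(y\<^sup>2) = y T(y) + T(y) y\<close>,
  hence by polarization and complex linearity that \<open>T\<close> is a Jordan derivation. The triple product is a
  combination of iterated Jordan products, so a Jordan derivation commuting with the involution is a
  triple derivation.

  The curve is the Cayley transform \<open>t \<mapsto> (1 + ty)(1 - ty)\<^sup>-\<^sup>1\<close>: it needs only the inverse of an
  element close to \<open>1\<close>, and clearing the inverses turns the tangency relation into an identity that is
  polynomial in \<open>t\<close> apart from one bounded factor. The steps are
  \<open>triple_derivation_at_unitary\<close>, \<open>tangent_at_cayley_transform\<close>,
  \<open>tangent_first_and_second_order\<close>, \<open>tangent_jordan_derivation\<close> and
  \<open>jordan_star_derivation_triple_derivation\<close>.
\<close>

section \<open>Scalars and the involution\<close>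

lemma scaleC_of_real: "complex_of_real r *\<^sub>C (x::'a::cstar_algebra) = r *\<^sub>R x"
  by (simp add: scaleR_scaleC)

lemma half_scaleC: "(1/2) *\<^sub>C (x::'a::cstar_algebra) = (1/2) *\<^sub>R x"
  using scaleC_of_real[of "1/2" x] by simp

lemma minus_scaleC: "(- 1) *\<^sub>C (x::'a::cstar_algebra) = - x"
  using scaleC_of_real[of "-1" x] by simp

lemma ii_scaleC_twice: "\<i> *\<^sub>C \<i> *\<^sub>C (x::'a::cstar_algebra) = - x"
  by (simp add: scaleC_scaleC minus_scaleC)

lemma star_scaleR: "star (r *\<^sub>R x) = r *\<^sub>R star (x::'a::cstar_algebra)"
  by (simp add: scaleR_scaleC star_scaleC)

lemma star_minus: "star (- x) = - star (x::'a::cstar_algebra)"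
  using star_scaleR[of "-1" x] by simp

lemma star_diff: "star (x - y) = star x - star (y::'a::cstar_algebra)"
  using star_add[of x "- y"] by (simp add: star_minus)

lemma star_one: "star (1::'a::unital_cstar_algebra) = 1"
  by (metis mult_1_left star_mult star_star mult_1_right)

lemma norm_star: "norm (star x) = norm (x::'a::cstar_algebra)"
proof -
  have le: "norm z \<le> norm (star z)" for z :: 'a
  proof (cases "z = 0")
    case False
    have "norm z * norm z \<le> norm (star z) * norm z"
      using norm_mult_ineq[of "star z" z] cstar_identity[of z] by (simp add: power2_eq_square)
    then show ?thesis
      using False by simp
  qed simp
  show ?thesis
    using le[of x] le[of "star x"] by (simp add: star_star)
qed

lemma bounded_linear_star: "bounded_linear (star :: 'a::cstar_algebra \<Rightarrow> 'a)"
  by (rule bounded_linear_intro[where K = 1]) (simp_all add: star_add star_scaleR norm_star)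

lemma clinear_add: "clinear f \<Longrightarrow> f (x + y) = f x + f y"
  by (simp add: clinear_def)

lemma clinear_scaleC: "clinear f \<Longrightarrow> f (c *\<^sub>C x) = c *\<^sub>C f x"
  by (simp add: clinear_def)

lemma clinear_scaleR: "clinear f \<Longrightarrow> f (r *\<^sub>R x) = r *\<^sub>R f x"
  by (simp add: scaleR_scaleC clinear_scaleC)

lemma clinear_minus: "clinear f \<Longrightarrow> f (- x) = - f x"
  using clinear_scaleR[of f "-1" x] by simp

lemma clinear_diff: "clinear f \<Longrightarrow> f (x - y) = f x - f y"
  using clinear_add[of f x "- y"] by (simp add: clinear_minus)

lemma cartesian_decomposition:
  fixes x :: "'a::cstar_algebra"
  obtains a b where "star a = a" "star b = b" "x = a + \<i> *\<^sub>C b"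
proof
  show "star ((1/2) *\<^sub>R (x + star x)) = (1/2) *\<^sub>R (x + star x)"
    by (simp add: star_add star_scaleR star_star add.commute)
  show "star ((1/2) *\<^sub>R (\<i> *\<^sub>C (star x - x))) = (1/2) *\<^sub>R (\<i> *\<^sub>C (star x - x))"
  proof -
    have "(- \<i>) *\<^sub>C (x - star x) = \<i> *\<^sub>C ((- 1) *\<^sub>C (x - star x))"
      by (simp add: scaleC_scaleC)
    then show ?thesis
      by (simp add: star_diff star_scaleC star_scaleR star_star minus_scaleC)
  qed
  have "\<i> *\<^sub>C ((1/2) *\<^sub>R (\<i> *\<^sub>C (star x - x))) = (1/2) *\<^sub>R (\<i> *\<^sub>C \<i> *\<^sub>C (star x - x))"
    by (simp add: scaleR_scaleC scaleC_scaleC mult.commute)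
  then show "x = (1/2) *\<^sub>R (x + star x) + \<i> *\<^sub>C ((1/2) *\<^sub>R (\<i> *\<^sub>C (star x - x)))"
    by (simp add: ii_scaleC_twice scaleR_add_left[symmetric] algebra_simps)
qed

section \<open>Triple derivations and unitaries\<close>

lemma triple_product_scaleR: "triple_product a b c = (1/2) *\<^sub>R (a * star b * c + c * star b * a)"
  by (simp add: triple_product_def half_scaleC)

lemma triple_derivation_add:
  assumes "triple_derivation D" "triple_derivation E"
  shows "triple_derivation (\<lambda>x. D x + E x)"
proof -
  have "clinear (\<lambda>x. D x + E x)"
    using assms by (simp add: triple_derivation_def clinear_def scaleC_add_right)
  moreover have "D (triple_product a b c) + E (triple_product a b c) =
      triple_product (D a + E a) b c + triple_product a (D b + E b) c
      + triple_product a b (D c + E c)" for a b c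
  proof -
    have "D (triple_product a b c) =
        triple_product (D a) b c + triple_product a (D b) c + triple_product a b (D c)"
      "E (triple_product a b c) =
        triple_product (E a) b c + triple_product a (E b) c + triple_product a b (E c)"
      using assms by (simp_all add: triple_derivation_def)
    then show ?thesis
      by (simp add: triple_product_scaleR star_add algebra_simps)
  qed
  ultimately show ?thesis
    by (simp add: triple_derivation_def)
qed

text \<open>
  In a unital algebra this is the inner triple derivation \<open>x \<mapsto> {h,1,x} - {1,h,x}\<close>. In expanding the
  rule at \<open>{a,b,c}\<close>, the middle factor contributes \<open>star (h * b + b * h)\<close>, whose sign flip
  cancels the terms with \<open>h\<close> inside the product and leaves \<open>h\<close> at the two ends.
\<close>

lemma triple_derivation_skew_anticommutator:
  fixes h :: "'a::cstar_algebra"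
  assumes "star h = - h"
  shows "triple_derivation (\<lambda>x. h * x + x * h)"
proof -
  have "clinear (\<lambda>x. h * x + x * h)"
    by (simp add: clinear_def scaleC_add_right mult_scaleC_left mult_scaleC_right algebra_simps)
  then show ?thesis
    by (simp add: triple_derivation_def triple_product_scaleR star_add star_mult assms
        algebra_simps)
qed

text \<open>
  Apply the derivation rule to \<open>{u,u,u} = u\<close>: the two outer slots each return \<open>D u\<close>, and the middle
  slot returns \<open>u * star (D u) * u\<close>. The right-hand side refers to \<open>D\<close> only through \<open>D u\<close>, which is
  why the identity passes to local triple derivations.
\<close>

lemma triple_derivation_at_unitary:
  fixes u :: "'a::unital_cstar_algebra"
  assumes "triple_derivation D" and u: "star u * u = 1" "u * star u = 1"
  shows "D u = - (u * star (D u) * u)"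
proof -
  have tp: "triple_product u u u = u"
    by (simp add: triple_product_scaleR u scaleR_add_left[symmetric] algebra_simps)
  have "D (triple_product u u u) = triple_product (D u) u u + triple_product u (D u) u
      + triple_product u u (D u)"
    using assms(1) by (simp add: triple_derivation_def)
  moreover have "triple_product (D u) u u = D u" "triple_product u u (D u) = D u"
    by (simp_all add: triple_product_scaleR u mult.assoc scaleR_add_left[symmetric] scaleR_add_right)
  moreover have "triple_product u (D u) u = u * star (D u) * u"
    by (simp add: triple_product_scaleR scaleR_add_left[symmetric] scaleR_add_right)
  ultimately have "D u = D u + u * star (D u) * u + D u"
    using tp by simp
  then show ?thesis
    by (simp add: algebra_simps eq_neg_iff_add_eq_0)
qed

section \<open>Cayley transforms\<close>

text \<open>
  A left and a right inverse are the fixed points of the contractions \<open>s \<mapsto> 1 + s * x\<close> and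
  \<open>s \<mapsto> 1 + x * s\<close>, and the two agree by associativity.
\<close>

lemma ex_inverse_one_minus:
  fixes x :: "'a::{real_normed_algebra,banach,monoid_mult}"
  assumes "norm x < 1"
  obtains s where "(1 - x) * s = 1" "s * (1 - x) = 1"
proof -
  have "\<exists>!s. 1 + x * s = s"
    using banach_fix_type[of "norm x" "\<lambda>s. 1 + x * s"] assms norm_mult_ineq[of x]
    by (simp add: dist_norm right_diff_distrib[symmetric])
  then obtain s where s: "1 + x * s = s"
    by blast
  have "norm (z * x) \<le> norm x * norm z" for z
    using norm_mult_ineq[of z x] by (simp add: mult.commute)
  then have "\<exists>!s. 1 + s * x = s"
    using banach_fix_type[of "norm x" "\<lambda>s. 1 + s * x"] assms
    by (simp add: dist_norm left_diff_distrib[symmetric])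
  then obtain s' where s': "1 + s' * x = s'"
    by blast
  have 1: "(1 - x) * s = 1" and 2: "s' * (1 - x) = 1"
    using s s' by (simp_all add: algebra_simps)
  then have "s' = s"
    by (metis mult.assoc mult_1_left mult_1_right)
  then show ?thesis
    using 1 2 that by blast
qed

lemma cayley_transform_unitary:
  fixes x s :: "'a::unital_cstar_algebra"
  assumes x: "star x = - x" and s: "(1 - x) * s = 1" "s * (1 - x) = 1"
  defines "u \<equiv> (1 + x) * s"
  shows "star u * u = 1" "u * star u = 1"
proof -
  have "s = 1 + x * s" "s = 1 + s * x"
    using s by (simp_all add: left_diff_distrib right_diff_distrib diff_eq_eq)
  then have "x * s = s * x"
    by (metis add_left_cancel)
  then have u: "u = s * (1 + x)"
    by (simp add: u_def distrib_left distrib_right)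
  have st: "star s * (1 + x) = 1" "(1 + x) * star s = 1"
    using arg_cong[OF s(1), of star] arg_cong[OF s(2), of star]
    by (simp_all add: star_mult star_diff star_one x)
  have comm: "(1 - x) * (1 + x) = (1 + x) * (1 - x)"
    by (simp add: algebra_simps)
  have "star u * u = star s * ((1 - x) * (1 + x)) * s"
    by (simp add: u_def star_mult star_add star_one x mult.assoc)
  also have "\<dots> = (star s * (1 + x)) * ((1 - x) * s)"
    unfolding comm by (simp only: mult.assoc)
  finally show "star u * u = 1"
    by (simp add: st s)
  have "u * star u = s * ((1 + x) * (1 - x)) * star s"
    by (simp add: u star_mult star_add star_one x mult.assoc)
  also have "\<dots> = (s * (1 - x)) * ((1 + x) * star s)"
    unfolding comm[symmetric] by (simp only: mult.assoc)
  finally show "u * star u = 1"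
    by (simp add: st s)
qed

section \<open>Expansion at the unit\<close>

text \<open>
  Multiplied by \<open>star u\<close> from the left, the equation says that \<open>star u * T u\<close> is skew-adjoint. The elements
  \<open>u * k\<close> with \<open>k\<close> skew-adjoint are the tangent vectors at \<open>u\<close> to the unitary group.
\<close>

definition tangent_at_unitaries :: "('a::unital_cstar_algebra \<Rightarrow> 'a) \<Rightarrow> bool" where
  "tangent_at_unitaries T \<longleftrightarrow>
    (\<forall>u. star u * u = 1 \<longrightarrow> u * star u = 1 \<longrightarrow> T u = - (u * star (T u) * u))"

text \<open>
  The tangency relation at the Cayley transform \<open>u\<close> of \<open>t *\<^sub>R y\<close>, multiplied by \<open>1 - t *\<^sub>R y\<close> on both
  sides: this turns \<open>u\<close> into \<open>1 + t *\<^sub>R y\<close> and leaves \<open>s\<close> only inside \<open>T\<close>. Since \<open>u = 1 + 2t y s\<close> and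
  \<open>T 1 = 0\<close>, the value \<open>T u\<close> is \<open>2t V\<close>, and the factor \<open>2t\<close> cancels.
\<close>

lemma tangent_at_cayley_transform:
  fixes T :: "'a::unital_cstar_algebra \<Rightarrow> 'a"
  assumes T: "clinear T" "tangent_at_unitaries T" "T 1 = 0"
    and y: "star y = - y" and t: "t \<noteq> 0"
    and s: "(1 - t *\<^sub>R y) * s = 1" "s * (1 - t *\<^sub>R y) = 1"
  defines "V \<equiv> T (y * s)"
  shows "(1 - t *\<^sub>R y) * V * (1 - t *\<^sub>R y) + (1 + t *\<^sub>R y) * star V * (1 + t *\<^sub>R y) = 0"
proof -
  define x where "x = t *\<^sub>R y"
  define u where "u = (1 + x) * s"
  have x: "star x = - x"
    by (simp add: x_def star_scaleR y)
  have s: "(1 - x) * s = 1" "s * (1 - x) = 1"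
    using s by (simp_all add: x_def)
  have seq: "s = 1 + x * s"
    using s by (simp add: algebra_simps)
  have "u = 1 + 2 *\<^sub>R (x * s)"
    using seq by (simp add: u_def scaleR_2 algebra_simps)
  then have Tu: "T u = (2 * t) *\<^sub>R V"
    using T(3) by (simp add: V_def x_def clinear_add[OF T(1)] clinear_scaleR[OF T(1)])
  have l: "(1 - x) * u = 1 + x"
  proof -
    have "(1 - x) * u = (1 + x) * ((1 - x) * s)"
      by (simp add: u_def algebra_simps)
    then show ?thesis by (simp add: s)
  qed
  have r: "u * (1 - x) = 1 + x"
    by (simp add: u_def mult.assoc s)
  have "T u = - (u * star (T u) * u)"
    using T(2) cayley_transform_unitary[OF x s] by (simp add: tangent_at_unitaries_def u_def)
  then have "(1 - x) * T u * (1 - x) = - (((1 - x) * u) * star (T u) * (u * (1 - x)))"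
    by (metis (no_types, lifting) mult.assoc mult_minus_left mult_minus_right)
  then have "(1 - x) * T u * (1 - x) + (1 + x) * star (T u) * (1 + x) = 0"
    by (simp add: l r)
  then have "(2 * t) *\<^sub>R ((1 - x) * V * (1 - x) + (1 + x) * star V * (1 + x)) = 0"
    by (simp add: Tu star_scaleR scaleR_add_right)
  then show ?thesis
    using t by (simp add: x_def)
qed

text \<open>
  Continuity at \<open>1\<close> of the inverse: \<open>S t - 1 = t y S t\<close>, and for small \<open>t\<close> this equation also bounds
  \<open>S t\<close> by twice the norm of \<open>1\<close>.
\<close>

lemma tendsto_inverse_one_minus:
  fixes y :: "'a::{real_normed_algebra,banach,monoid_mult}"
  obtains S :: "real \<Rightarrow> 'a" where "(S \<longlongrightarrow> 1) (at 0)"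
    "\<forall>\<^sub>F t in at 0. (1 - t *\<^sub>R y) * S t = 1 \<and> S t * (1 - t *\<^sub>R y) = 1"
proof -
  have "\<exists>s. norm (t *\<^sub>R y) < 1 \<longrightarrow> (1 - t *\<^sub>R y) * s = 1 \<and> s * (1 - t *\<^sub>R y) = 1" for t
    using ex_inverse_one_minus[of "t *\<^sub>R y"] by metis
  then obtain S where S:
    "\<And>t. norm (t *\<^sub>R y) < 1 \<Longrightarrow> (1 - t *\<^sub>R y) * S t = 1 \<and> S t * (1 - t *\<^sub>R y) = 1"
    by metis
  have lim: "((\<lambda>t. norm (t *\<^sub>R y)) \<longlongrightarrow> 0) (at 0)"
    by (auto intro!: tendsto_eq_intros)
  have small: "\<forall>\<^sub>F t in at 0. norm (t *\<^sub>R y) < 1/2"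
    using order_tendstoD(2)[OF lim, of "1/2"] by simp
  have "((\<lambda>t. S t - 1) \<longlongrightarrow> 0) (at 0)"
  proof (rule Lim_null_comparison)
    show "\<forall>\<^sub>F t in at 0. norm (S t - 1) \<le> norm (t *\<^sub>R y) * (2 * norm (1::'a))"
      using small
    proof eventually_elim
      case (elim t)
      then have e: "S t - 1 = (t *\<^sub>R y) * S t"
        using S[of t] by (simp add: algebra_simps)
      have a: "norm (S t - 1) \<le> norm (t *\<^sub>R y) * norm (S t)"
        unfolding e by (rule norm_mult_ineq)
      also have "\<dots> \<le> (1/2) * norm (S t)"
        using elim by (intro mult_right_mono) auto
      finally have "norm (S t) \<le> 2 * norm (1::'a)"
        using norm_triangle_ineq2[of "S t" 1] by linarith
      then show ?case
        using a by (meson mult_left_mono norm_ge_zero order_trans)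
    qed
    show "((\<lambda>t. norm (t *\<^sub>R y) * (2 * norm (1::'a))) \<longlongrightarrow> 0) (at 0)"
      using tendsto_mult_right[OF lim, of "2 * norm (1::'a)"] by simp
  qed
  then have "(S \<longlongrightarrow> 1) (at 0)"
    by (simp add: LIM_zero_iff)
  moreover have "\<forall>\<^sub>F t in at 0. (1 - t *\<^sub>R y) * S t = 1 \<and> S t * (1 - t *\<^sub>R y) = 1"
    using small by eventually_elim (rule S, simp)
  ultimately show ?thesis
    using that by blast
qed

lemma limit_eq_zero:
  fixes f :: "real \<Rightarrow> 'a::real_normed_vector"
  assumes "(f \<longlongrightarrow> l) (at 0)" "\<forall>\<^sub>F t in at 0. f t = 0"
  shows "l = 0"
proof -
  have "((\<lambda>_. 0) \<longlongrightarrow> l) (at (0::real))"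
    using assms tendsto_cong by fastforce
  then show ?thesis
    by (simp add: tendsto_const_iff)
qed

text \<open>
  Both conclusions compare coefficients in the identity of \<open>tangent_at_cayley_transform\<close>. The limit
  \<open>t \<rightarrow> 0\<close> gives the first. Inserting the first, the terms of order zero cancel, and
  dividing by \<open>t\<close> before passing to the limit gives the second.
\<close>

lemma tangent_first_and_second_order:
  fixes T :: "'a::unital_cstar_algebra \<Rightarrow> 'a"
  assumes T: "clinear T" "bounded_linear T" "tangent_at_unitaries T" "T 1 = 0"
    and y: "star y = - y"
  shows "star (T y) = - T y"
    and "T (y * y) + star (T (y * y)) = 2 *\<^sub>R (y * T y + T y * y)"
proof -
  obtain S where S: "(S \<longlongrightarrow> 1) (at 0)"
    and inv: "\<forall>\<^sub>F t in at 0. (1 - t *\<^sub>R y) * S t = 1 \<and> S t * (1 - t *\<^sub>R y) = 1"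
    by (rule tendsto_inverse_one_minus)
  note [tendsto_intros] = bounded_linear.tendsto[OF T(2)] bounded_linear.tendsto[OF bounded_linear_star]
  define V where "V t = T (y * S t)" for t
  define U where "U t = T (y * y * S t)" for t
  have V: "(V \<longlongrightarrow> T y) (at 0)" and U: "(U \<longlongrightarrow> T (y * y)) (at 0)"
    unfolding V_def U_def by (auto intro!: tendsto_eq_intros S)
  have nz: "\<forall>\<^sub>F t in at (0::real). t \<noteq> 0"
    by (simp add: eventually_at_filter)
  have id: "\<forall>\<^sub>F t in at 0.
      (1 - t *\<^sub>R y) * V t * (1 - t *\<^sub>R y) + (1 + t *\<^sub>R y) * star (V t) * (1 + t *\<^sub>R y) = 0"
    using inv nz
    by eventually_elim (use tangent_at_cayley_transform[OF T(1,3,4) y] V_def in auto)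
  have "((\<lambda>t. (1 - t *\<^sub>R y) * V t * (1 - t *\<^sub>R y) + (1 + t *\<^sub>R y) * star (V t) * (1 + t *\<^sub>R y))
      \<longlongrightarrow> T y + star (T y)) (at 0)"
    by (rule tendsto_eq_intros V refl | simp)+
  then have "T y + star (T y) = 0"
    using id by (rule limit_eq_zero)
  then show first: "star (T y) = - T y"
    by (simp add: eq_neg_iff_add_eq_0 add.commute)
  \<comment> \<open>\<open>R t\<close> is the left-hand side of the Cayley identity divided by \<open>t\<close>, after substituting
    \<open>V t = T y + t *\<^sub>R U t\<close>.\<close>
  define R where "R t = U t + star (U t) - 2 *\<^sub>R (y * T y + T y * y)
    + t *\<^sub>R (y * star (U t) + star (U t) * y - y * U t - U t * y)
    + (t * t) *\<^sub>R (y * U t * y + y * star (U t) * y)" for t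
  have "\<forall>\<^sub>F t in at 0. R t = 0"
    using inv nz id
  proof eventually_elim
    case (elim t)
    have "S t = 1 + t *\<^sub>R (y * S t)"
      using elim(1) by (simp add: algebra_simps)
    then have "y * S t = y + t *\<^sub>R (y * y * S t)"
      by (metis distrib_left mult.assoc mult_1_right mult_scaleR_right)
    then have Vt: "V t = T y + t *\<^sub>R U t"
      unfolding V_def U_def by (metis clinear_add clinear_scaleR T(1))
    have "t *\<^sub>R R t = 0"
      using elim(3) unfolding Vt R_def
      by (simp add: star_add star_scaleR first scaleR_2 algebra_simps)
    then show ?case
      using elim(2) by simp
  qed
  moreover have "(R \<longlongrightarrow> T (y * y) + star (T (y * y)) - 2 *\<^sub>R (y * T y + T y * y)) (at 0)"
    unfolding R_def by (rule tendsto_eq_intros U refl | simp)+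
  ultimately show "T (y * y) + star (T (y * y)) = 2 *\<^sub>R (y * T y + T y * y)"
    using limit_eq_zero by fastforce
qed

section \<open>Jordan derivations\<close>

text \<open>
  A complex linear map preserving skew-adjointness also preserves self-adjointness, by
  multiplication with \<open>\<i>\<close>, and hence respects the decomposition into real and imaginary parts.
\<close>

lemma tangent_star_preserving:
  fixes T :: "'a::unital_cstar_algebra \<Rightarrow> 'a"
  assumes T: "clinear T" "bounded_linear T" "tangent_at_unitaries T" "T 1 = 0"
  shows "T (star x) = star (T x)"
proof -
  have skew: "star (T y) = - T y" if "star y = - y" for y
    using tangent_first_and_second_order(1)[OF T that] .
  have sa: "star (T a) = T a" if "star a = a" for a
  proof -
    have "star (\<i> *\<^sub>C a) = - (\<i> *\<^sub>C a)"
      using that minus_scaleC[of "\<i> *\<^sub>C a"] by (simp add: star_scaleC scaleC_scaleC)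
    then have "star (\<i> *\<^sub>C T a) = - (\<i> *\<^sub>C T a)"
      using skew clinear_scaleC[OF T(1)] by metis
    then have "\<i> *\<^sub>C (- \<i>) *\<^sub>C star (T a) = \<i> *\<^sub>C (- 1) *\<^sub>C (\<i> *\<^sub>C T a)"
      by (simp add: star_scaleC minus_scaleC)
    then show ?thesis
      by (simp add: scaleC_scaleC scaleC_one)
  qed
  obtain a b where ab: "star a = a" "star b = b" "x = a + \<i> *\<^sub>C b"
    by (rule cartesian_decomposition)
  show ?thesis
    by (simp add: ab star_add star_scaleC clinear_add[OF T(1)] clinear_scaleC[OF T(1)] sa)
qed

text \<open>
  Since \<open>T\<close> commutes with the involution and \<open>y\<^sup>2\<close> is self-adjoint for skew-adjoint \<open>y\<close>, the second-order
  relation becomes \<open>T (y * y) = y * T y + T y * y\<close>. Polarizing gives the claim for skew-adjoint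
  pairs, and these span the algebra over the complex numbers.
\<close>

lemma tangent_jordan_derivation:
  fixes T :: "'a::unital_cstar_algebra \<Rightarrow> 'a"
  assumes T: "clinear T" "bounded_linear T" "tangent_at_unitaries T" "T 1 = 0"
  shows "T (x * z + z * x) = T x * z + x * T z + T z * x + z * T x"
proof -
  note lin = clinear_add[OF T(1)] clinear_scaleC[OF T(1)]
  have skew_square: "T (y * y) = y * T y + T y * y" if "star y = - y" for y
  proof -
    have "star (T (y * y)) = T (y * y)"
      using tangent_star_preserving[OF T, of "y * y"] that by (simp add: star_mult)
    then have "2 *\<^sub>R T (y * y) = 2 *\<^sub>R (y * T y + T y * y)"
      using tangent_first_and_second_order(2)[OF T that] by (simp add: scaleR_2)
    then show ?thesis
      by simp
  qed
  have skew_skew: "T (x * z + z * x) = T x * z + x * T z + T z * x + z * T x"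
    if "star x = - x" "star z = - z" for x z
  proof -
    have "star (x + z) = - (x + z)"
      using that by (simp add: star_add)
    from skew_square[OF this] skew_square[OF that(1)] skew_square[OF that(2)]
    show ?thesis
      by (simp add: lin algebra_simps)
  qed
  have decomp: "\<exists>a b. star a = - a \<and> star b = - b \<and> w = a + \<i> *\<^sub>C b" for w :: 'a
  proof -
    obtain a b where ab: "star a = a" "star b = b" "w = a + \<i> *\<^sub>C b"
      by (rule cartesian_decomposition)
    have "star (\<i> *\<^sub>C b) = - (\<i> *\<^sub>C b)" "star ((- \<i>) *\<^sub>C a) = - ((- \<i>) *\<^sub>C a)"
      using ab minus_scaleC[of "\<i> *\<^sub>C b"] minus_scaleC[of "(- \<i>) *\<^sub>C a"]
      by (simp_all add: star_scaleC scaleC_scaleC)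
    moreover have "w = \<i> *\<^sub>C b + \<i> *\<^sub>C ((- \<i>) *\<^sub>C a)"
      using ab by (simp add: scaleC_scaleC scaleC_one add.commute)
    ultimately show ?thesis
      by blast
  qed
  obtain a b c d where "star a = - a" "star b = - b" "x = a + \<i> *\<^sub>C b"
    "star c = - c" "star d = - d" "z = c + \<i> *\<^sub>C d"
    using decomp by metis
  note abcd = this
  have "x * z + z * x = (a * c + c * a) + \<i> *\<^sub>C (a * d + d * a) + \<i> *\<^sub>C (b * c + c * b)
      + \<i> *\<^sub>C \<i> *\<^sub>C (b * d + d * b)"
    by (simp add: abcd mult_scaleC_left mult_scaleC_right scaleC_add_right algebra_simps)
  then have "T (x * z + z * x) = T (a * c + c * a) + \<i> *\<^sub>C T (a * d + d * a)
      + \<i> *\<^sub>C T (b * c + c * b) + \<i> *\<^sub>C \<i> *\<^sub>C T (b * d + d * b)"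
    by (simp only: lin)
  then show ?thesis
    by (simp add: skew_skew abcd)
      (simp add: lin mult_scaleC_left mult_scaleC_right scaleC_add_right algebra_simps)
qed

text \<open>
  With the Jordan product \<open>x \<circ> z = xz + zx\<close> one has
  \<open>2(abc + cba) = (a \<circ> b) \<circ> c + (b \<circ> c) \<circ> a - (a \<circ> c) \<circ> b\<close>, so \<open>T\<close> obeys the Leibniz rule on
  \<open>abc + cba\<close>. Commuting with the involution allows replacing \<open>b\<close> by \<open>star b\<close>.
\<close>

lemma jordan_star_derivation_triple_derivation:
  fixes T :: "'a::cstar_algebra \<Rightarrow> 'a"
  assumes T: "clinear T"
    and J: "\<And>x z. T (x * z + z * x) = T x * z + x * T z + T z * x + z * T x"
    and star: "\<And>x. T (star x) = star (T x)"
  shows "triple_derivation T"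
proof -
  have mix: "T (a * b * c + c * b * a) = T a * b * c + a * T b * c + a * b * T c
      + (T c * b * a + c * T b * a + c * b * T a)" for a b c
  proof -
    let ?o = "\<lambda>x z. x * z + z * x"
    have "2 *\<^sub>R (a * b * c + c * b * a) = ?o (?o a b) c + ?o (?o b c) a - ?o (?o a c) b"
      by (simp add: scaleR_2 algebra_simps)
    then have "2 *\<^sub>R T (a * b * c + c * b * a)
        = T (?o (?o a b) c) + T (?o (?o b c) a) - T (?o (?o a c) b)"
      by (metis clinear_scaleR[OF T] clinear_add[OF T] clinear_diff[OF T])
    also have "\<dots> = 2 *\<^sub>R (T a * b * c + a * T b * c + a * b * T c
      + (T c * b * a + c * T b * a + c * b * T a))"
      unfolding J by (simp add: scaleR_2 algebra_simps)
    finally show ?thesis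
      by simp
  qed
  show ?thesis
    unfolding triple_derivation_def
  proof (intro conjI allI)
    show "T (triple_product a b c) =
        triple_product (T a) b c + triple_product a (T b) c + triple_product a b (T c)" for a b c
      unfolding triple_product_scaleR clinear_scaleR[OF T] mix star
      by (simp add: algebra_simps)
  qed (rule T)
qed

theorem theorem10:
  fixes T :: "'a::unital_cstar_algebra \<Rightarrow> 'a"
  assumes "local_triple_derivation T"
  shows "triple_derivation T"
proof -
  have T: "clinear T" "bounded_linear T" "\<And>a. \<exists>D. triple_derivation D \<and> T a = D a"
    using assms by (simp_all add: local_triple_derivation_def)
  have tangent: "T u = - (u * star (T u) * u)" if "star u * u = 1" "u * star u = 1" for u
    using T(3)[of u] triple_derivation_at_unitary[OF _ that] by metis
  define h where "h = (1/2) *\<^sub>R T 1"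
  have "T 1 = - star (T 1)"
    using tangent[of 1] by (simp add: star_one)
  then have h: "star h = - h"
    unfolding h_def by (metis minus_minus scaleR_minus_right star_scaleR)
  define L where "L x = h * x + x * h" for x
  have L: "triple_derivation L"
    using triple_derivation_skew_anticommutator[OF h] by (simp add: L_def[abs_def])
  define T' where "T' x = T x - L x" for x
  have lin: "clinear T'"
    using T(1) L unfolding T'_def clinear_def triple_derivation_def
    by (metis (no_types, lifting) add_diff_add diff_conv_add_uminus minus_scaleC mult.commute
        scaleC_add_right scaleC_scaleC)
  have "bounded_linear L"
    unfolding L_def by (intro bounded_linear_add bounded_linear_mult_left bounded_linear_mult_right)
  then have bdd: "bounded_linear T'"
    unfolding T'_def using T(2) by (intro bounded_linear_sub)
  have "tangent_at_unitaries T'"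
    unfolding tangent_at_unitaries_def
  proof (intro allI impI)
    fix u :: 'a
    assume u: "star u * u = 1" "u * star u = 1"
    have "T' u = - (u * star (T u) * u) - - (u * star (L u) * u)"
      unfolding T'_def using tangent[OF u] triple_derivation_at_unitary[OF L u] by simp
    then show "T' u = - (u * star (T' u) * u)"
      by (simp add: T'_def star_diff algebra_simps)
  qed
  moreover have "T' 1 = 0"
    by (simp add: T'_def L_def h_def scaleR_add_left[symmetric])
  ultimately have "triple_derivation T'"
    using jordan_star_derivation_triple_derivation[OF lin]
      tangent_jordan_derivation[OF lin bdd] tangent_star_preserving[OF lin bdd] by blast
  then have "triple_derivation (\<lambda>x. T' x + L x)"
    using L by (rule triple_derivation_add)
  then show ?thesis
    by (simp add: T'_def)
qed

end
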